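(* Let $\Omega\subseteq\mathbb{R}^d$ be open with $\mu(\Omega)<\infty$, let $p(\cdot)\in\mathcal{P}$ with $p_+<\infty$ and let $1<q\le\infty$. If there exists $x_0\in\Omega$ such that $p(x_0)=p_-$ and $p(\cdot)\in LH_0\{x_0\}$, then the growth envelope of the variable Lorentz space is $$\mathfrak{E}_{\mathsf G}(L_{p(\cdot),q}(\Omega))=\left(t^{-1/p_-},\ q\right).$$
   Context: $\mu$ is Lebesgue measure on $\Omega$; $\chi_A$ is the characteristic function of $A$. For a measurable $p(\cdot):\Omega\to(0,\infty)$ put $p_-=\operatorname{ess\,inf}_{x\in\Omega}p(x)$, $p_+=\operatorname{ess\,sup}_{x\in\Omega}p(x)$. $\mathcal{P}$ is the set of such functions with $p_->0$ (exponent functions). Log-Hölder continuity: $r(\cdot)\in LH_0\{x_0\}$ (locally log-Hölder continuous at $x_0\in\Omega$) if there is $C_0>0$ with $|r(x)-r(x_0)|\le\frac{C_0}{-\log(|x-x_0|)}$ for all $x\in\Omega$ with $|x-x_0|<1/2$. Variable Lebesgue quasi-norm: $\|f\|_{p(\cdot)}=\inf\{\lambda>0:\int_\Omega(|f(x)|/\lambda)^{p(x)}\,dx\le1\}$. Variable Lorentz space $L_{p(\cdot),q}(\Omega)$: the measurable $f:\Omega\to\mathbb{R}$ with finite quasi-norm $$\|f\|_{L_{p(\cdot),q}}=\left(\int_0^\infty u^q\,\|\chi_{\{|f|>u\}}\|_{p(\cdot)}^q\,\frac{du}{u}\right)^{1/q}\ (0<q<\infty),\qquad \|f\|_{L_{p(\cdot),\infty}}=\sup_{u>0}u\,\|\chi_{\{|f|>u\}}\|_{p(\cdot)}.$$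 Rearrangement: $f^*(t)=\inf\{s>0:\mu(\{|f|>s\})\le t\}$, $t\ge0$ (with $\inf\emptyset=\infty$). Growth envelope: for a quasi-normed function space $X$ on $\Omega$, $\mathcal{E}_{\mathsf G}^X(t)=\sup\{f^*(t):\|f\|_X\le1\}$, $t>0$. Growth envelope functions are considered up to equivalence near $0$. For a positive, decreasing, continuously differentiable function $\Psi$ and $u\in(0,\infty]$, the equality $\mathfrak{E}_{\mathsf G}(X)=(\Psi(t),u)$ means: (i) there are $\varepsilon>0$ and constants $A,B>0$ with $A\,\Psi(t)\le\mathcal{E}_{\mathsf G}^X(t)\le B\,\Psi(t)$ for $0<t<\varepsilon$; and (ii) $u$ is the infimum of all $0<v\le\infty$ for which, for some $c>0$ and a fixed sufficiently small $\varepsilon>0$, $$\left(-\int_0^\varepsilon\left(\frac{f^*(t)}{\Psi(t)}\right)^v\frac{\Psi'(t)}{\Psi(t)}\,dt\right)^{1/v}\le c\,\|f\|_X\quad\text{for all }f\in X$$ (for $v=\infty$: $\sup_{0<t<\varepsilon}f^*(t)/\Psi(t)\le c\|f\|_X$). For $\Psi(t)=t^{-1/r}$ the measure $-\frac{\Psi'(t)}{\Psi(t)}dt$ is a constant multiple of $\frac{dt}{t}$. *)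

theory Defs
  imports "HOL-Probability.Essential_Supremum"
begin

text \<open>
  Functions on \<open>\<Omega>\<close> are total functions on the ambient space whose values outside \<open>\<Omega>\<close> are
  never inspected; \<open>\<mu>\<close> is \<open>lebesgue_on \<Omega>\<close>.
\<close>

definition essinf :: "'a measure \<Rightarrow> ('a \<Rightarrow> ereal) \<Rightarrow> ereal"
  where "essinf M f = - esssup M (\<lambda>x. - f x)"

definition exp_minus :: "'a::euclidean_space set \<Rightarrow> ('a \<Rightarrow> real) \<Rightarrow> ereal"
  where "exp_minus \<Omega> p = essinf (lebesgue_on \<Omega>) (\<lambda>x. ereal (p x))"

definition exp_plus :: "'a::euclidean_space set \<Rightarrow> ('a \<Rightarrow> real) \<Rightarrow> ereal"
  where "exp_plus \<Omega> p = esssup (lebesgue_on \<Omega>) (\<lambda>x. ereal (p x))"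

definition exponent_functions :: "'a::euclidean_space set \<Rightarrow> ('a \<Rightarrow> real) set"
  where "exponent_functions \<Omega> =
    {p. p \<in> borel_measurable (lebesgue_on \<Omega>) \<and> (\<forall>x\<in>\<Omega>. 0 < p x) \<and> 0 < exp_minus \<Omega> p}"

text \<open>At \<open>x = x0\<close> both sides of the inequality vanish, since \<open>ln 0 = 0\<close> and \<open>C / 0 = 0\<close>.\<close>

definition log_Hoelder_at :: "'a::euclidean_space set \<Rightarrow> 'a \<Rightarrow> ('a \<Rightarrow> real) \<Rightarrow> bool"
  where "log_Hoelder_at \<Omega> x0 r \<longleftrightarrow>
    (\<exists>C>0. \<forall>x\<in>\<Omega>. norm (x - x0) < 1/2 \<longrightarrow> \<bar>r x - r x0\<bar> \<le> C / (- ln (norm (x - x0))))"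

text \<open>Real powers of extended nonnegative numbers; only used for exponents \<open>a > 0\<close>.\<close>

definition epowr :: "ennreal \<Rightarrow> real \<Rightarrow> ennreal"
  where "epowr x a = (if x = \<infinity> then \<infinity> else ennreal (enn2real x powr a))"

definition var_norm :: "'a::euclidean_space set \<Rightarrow> ('a \<Rightarrow> real) \<Rightarrow> ('a \<Rightarrow> real) \<Rightarrow> ennreal"
  where "var_norm \<Omega> p f =
    (INF l \<in> {l::real. 0 < l \<and>
        (\<integral>\<^sup>+x. ennreal ((\<bar>f x\<bar> / l) powr p x) \<partial>lebesgue_on \<Omega>) \<le> 1}. ennreal l)"

definition lorentz_norm ::
    "'a::euclidean_space set \<Rightarrow> ('a \<Rightarrow> real) \<Rightarrow> ennreal \<Rightarrow> ('a \<Rightarrow> real) \<Rightarrow> ennreal"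
  where "lorentz_norm \<Omega> p q f =
    (if q = \<infinity>
     then (SUP u \<in> {0::real<..}. ennreal u * var_norm \<Omega> p (indicator {x\<in>\<Omega>. \<bar>f x\<bar> > u}))
     else epowr (\<integral>\<^sup>+u\<in>{0::real<..}.
            (ennreal (u powr enn2real q)
              * epowr (var_norm \<Omega> p (indicator {x\<in>\<Omega>. \<bar>f x\<bar> > u})) (enn2real q)
              / ennreal u) \<partial>lborel)
          (1 / enn2real q))"

definition lorentz_space ::
    "'a::euclidean_space set \<Rightarrow> ('a \<Rightarrow> real) \<Rightarrow> ennreal \<Rightarrow> ('a \<Rightarrow> real) set"
  where "lorentz_space \<Omega> p q =
    {f. f \<in> borel_measurable (lebesgue_on \<Omega>) \<and> lorentz_norm \<Omega> p q f < \<infinity>}"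

definition rearrangement :: "'a::euclidean_space set \<Rightarrow> ('a \<Rightarrow> real) \<Rightarrow> real \<Rightarrow> ennreal"
  where "rearrangement \<Omega> f t =
    (INF s \<in> {s::real. 0 < s \<and>
        emeasure (lebesgue_on \<Omega>) {x\<in>\<Omega>. \<bar>f x\<bar> > s} \<le> ennreal t}. ennreal s)"

text \<open>
  Below, a quasi-normed function space on \<open>\<Omega>\<close> is given by its underlying set \<open>X\<close> of functions
  and its quasi-norm \<open>N\<close>.
\<close>

definition growth_envelope_fun ::
    "'a::euclidean_space set \<Rightarrow> ('a \<Rightarrow> real) set \<Rightarrow> (('a \<Rightarrow> real) \<Rightarrow> ennreal) \<Rightarrow> real \<Rightarrow> ennreal"
  where "growth_envelope_fun \<Omega> X N t = (SUP f \<in> {f\<in>X. N f \<le> 1}. rearrangement \<Omega> f t)"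

text \<open>
  The left-hand side of the inequality defining the index. For decreasing \<open>\<Psi>\<close> the density
  \<open>- \<Psi>' / \<Psi>\<close> is nonnegative, so the minus sign may be taken inside the integral.
\<close>

definition envelope_functional ::
    "'a::euclidean_space set \<Rightarrow> (real \<Rightarrow> real) \<Rightarrow> real \<Rightarrow> ennreal \<Rightarrow> ('a \<Rightarrow> real) \<Rightarrow> ennreal"
  where "envelope_functional \<Omega> \<Psi> \<epsilon> v f =
    (if v = \<infinity>
     then (SUP t \<in> {0<..<\<epsilon>}. rearrangement \<Omega> f t / ennreal (\<Psi> t))
     else epowr (\<integral>\<^sup>+t\<in>{0<..<\<epsilon>}.
            (epowr (rearrangement \<Omega> f t / ennreal (\<Psi> t)) (enn2real v)
              * ennreal (- deriv \<Psi> t / \<Psi> t)) \<partial>lborel)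
          (1 / enn2real v))"

text \<open>
  The number \<open>\<epsilon>\<close> in the definition of the index is fixed before \<open>v\<close> and \<open>c\<close>; ``sufficiently
  small'' is rendered by \<open>at_right 0\<close>, i.e. the index is \<open>u\<close> for every small enough choice.
\<close>

definition has_growth_envelope ::
    "'a::euclidean_space set \<Rightarrow> ('a \<Rightarrow> real) set \<Rightarrow> (('a \<Rightarrow> real) \<Rightarrow> ennreal)
      \<Rightarrow> (real \<Rightarrow> real) \<Rightarrow> ennreal \<Rightarrow> bool"
  where "has_growth_envelope \<Omega> X N \<Psi> u \<longleftrightarrow>
    (\<forall>t>0. 0 < \<Psi> t) \<and> antimono_on {0<..} \<Psi> \<and> \<Psi> C1_differentiable_on {0<..} \<and>
    (\<exists>\<epsilon>>0. \<exists>A>0. \<exists>B>0. \<forall>t. 0 < t \<and> t < \<epsilon> \<longrightarrow>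
        ennreal (A * \<Psi> t) \<le> growth_envelope_fun \<Omega> X N t \<and>
        growth_envelope_fun \<Omega> X N t \<le> ennreal (B * \<Psi> t)) \<and>
    (\<forall>\<^sub>F \<epsilon> in at_right 0.
        u = Inf {v. 0 < v \<and>
          (\<exists>c::real>0. \<forall>f\<in>X. envelope_functional \<Omega> \<Psi> \<epsilon> v f \<le> ennreal c * N f)})"

end

theory Submission
  imports Defs "HOL-Analysis.Ball_Volume"
begin

text \<open>
  Write \<open>P\<close> for the essential infimum of \<open>p\<close>. Since \<open>P \<le> p\<close> almost everywhere, the quasi-norm of the
  indicator of \<open>A\<close> is at least \<open>(min 1 (\<mu> A)) powr (1 / P)\<close>; a layer-cake argument then bounds the
  envelope functional with exponent \<open>q\<close>, and the rearrangement itself, by the Lorentz norm.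
  Conversely, log-Hoelder continuity at \<open>x0\<close> makes \<open>r powr (p x - P)\<close> bounded above and below for
  \<open>x\<close> in the ball of radius \<open>r\<close> about \<open>x0\<close>, so there the bound is sharp up to a constant. Hence the
  powers \<open>norm (x - x0) powr (- d / P)\<close>, restricted to a ball of radius \<open>\<rho>\<close> and truncated at distance
  \<open>R\<close>, have norm of order \<open>(1 + ln (\<rho> / R)) powr (1 / q)\<close>. For \<open>\<rho> = 2 * R\<close> they show that the envelope is at least
  a multiple of \<open>t powr (- 1 / P)\<close>; for fixed \<open>\<rho>\<close> and \<open>R \<rightarrow> 0\<close> the functional with exponent
  \<open>v < q\<close> grows like \<open>(ln (\<rho> / R)) powr (1 / v)\<close>, which rules out such \<open>v\<close>.
\<close>

section \<open>Powers of extended nonnegative numbers and elementary integrals\<close>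

lemma epowr_ennreal: "0 \<le> x \<Longrightarrow> epowr (ennreal x) a = ennreal (x powr a)"
  by (simp add: epowr_def)

lemma epowr_mono: "x \<le> y \<Longrightarrow> 0 < a \<Longrightarrow> epowr x a \<le> epowr y a"
  unfolding epowr_def
  by (auto simp: top_unique less_top intro!: ennreal_leI powr_mono2 enn2real_mono)

lemma epowr_divide_ennreal:
  assumes "0 < z" "0 < a"
  shows "epowr (y / ennreal z) a = epowr y a / ennreal (z powr a)"
proof (cases y)
  case (real r)
  then show ?thesis
    using assms by (simp add: epowr_ennreal divide_ennreal powr_divide)
next
  case top
  then show ?thesis
    using assms by (simp add: epowr_def ennreal_top_divide)
qed

lemma nn_integral_powr_from_0:
  fixes a b :: real
  assumes "0 < a" "0 \<le> b"
  shows "(\<integral>\<^sup>+t\<in>{0<..<b}. ennreal (t powr (a - 1)) \<partial>lborel) = ennreal (b powr a / a)"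
proof -
  have "((\<lambda>t. t powr (a - 1)) has_integral (b powr (a - 1 + 1) / (a - 1 + 1))) {0..b}"
    using assms by (intro has_integral_powr_from_0) auto
  then have "((\<lambda>t. t powr (a - 1)) has_integral (b powr a / a)) {0<..<b}"
    by (simp add: has_integral_Icc_iff_Ioo)
  then have "((\<lambda>t. if t \<in> {0<..<b} then t powr (a - 1) else 0) has_integral (b powr a / a)) UNIV"
    by (simp only: has_integral_restrict_UNIV)
  then have "(\<integral>\<^sup>+t. ennreal (if t \<in> {0<..<b} then t powr (a - 1) else 0) \<partial>lborel) = ennreal (b powr a / a)"
    by (intro nn_integral_has_integral_lborel) auto
  moreover have "(\<lambda>t. ennreal (if t \<in> {0<..<b} then t powr (a - 1) else 0)) =
      (\<lambda>t. ennreal (t powr (a - 1)) * indicator {0<..<b} t)"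
    by (auto simp: indicator_def)
  ultimately show ?thesis by simp
qed

lemma nn_integral_inverse_Icc:
  fixes a b :: real
  assumes "0 < a" "a \<le> b"
  shows "(\<integral>\<^sup>+t\<in>{a..b}. ennreal (1 / t) \<partial>lborel) = ennreal (ln b - ln a)"
  by (rule nn_integral_FTC_Icc) (use assms in \<open>auto intro!: derivative_eq_intros\<close>)

text \<open>The power is the integral of its derivative over the levels below \<open>y\<close>,
  including \<open>y = \<infinity>\<close>. This layer-cake form turns a power of the rearrangement
  into an integral that can be exchanged with another.\<close>

lemma epowr_eq_nn_integral:
  assumes "0 < a"
  shows "epowr y a = (\<integral>\<^sup>+u. ennreal (a * u powr (a - 1)) * indicator {u. 0 < u \<and> ennreal u < y} u \<partial>lborel)"
    (is "_ = ?I y")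
proof -
  have fin: "?I (ennreal b) = ennreal (b powr a)" if "0 \<le> b" for b
  proof -
    have "?I (ennreal b) = (\<integral>\<^sup>+u. ennreal a * (ennreal (u powr (a - 1)) * indicator {0<..<b} u) \<partial>lborel)"
      using assms that
      by (intro nn_integral_cong) (auto simp: ennreal_mult indicator_def ennreal_less_iff)
    also have "\<dots> = ennreal a * ennreal (b powr a / a)"
      by (subst nn_integral_cmult) (use assms that in \<open>auto simp: nn_integral_powr_from_0\<close>)
    finally show ?thesis
      using assms by (simp flip: ennreal_mult)
  qed
  show ?thesis
  proof (cases y)
    case (real r)
    then show ?thesis by (simp add: fin epowr_ennreal)
  next
    case top
    have "?I top = top"
    proof (rule ccontr)
      assume "?I top \<noteq> top"
      then obtain c where c: "0 \<le> c" "?I top = ennreal c" by (cases "?I top") auto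
      \<comment> \<open>A supposed finite value \<open>c\<close> is exceeded at the finite level
        whose \<open>a\<close>-th power is \<open>c + 1\<close>.\<close>
      have "ennreal (((c + 1) powr (1 / a)) powr a) = ?I (ennreal ((c + 1) powr (1 / a)))"
        by (simp add: fin)
      also have "\<dots> \<le> ?I top"
        by (intro nn_integral_mono) (auto simp: indicator_def less_top)
      finally show False
        using c assms by (simp add: powr_powr)
    qed
    with top show ?thesis by (simp add: epowr_def)
  qed
qed

section \<open>Lower bounds for the Lorentz quasi-norm\<close>

text \<open>An admissible \<open>l < 1\<close> satisfies
  \<open>l powr (- P) \<le> l powr (- p x)\<close> almost everywhere, so the modular is at least
  \<open>l powr (- P) * m\<close> and \<open>m \<le> l powr P\<close>. For \<open>l \<ge> 1\<close>
  the comparison of powers reverses and the bound rests on \<open>m \<le> 1\<close>; hence the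
  cap.\<close>

lemma var_norm_indicator_ge:
  assumes A: "A \<in> sets (lebesgue_on \<Omega>)" and p: "AE x in lebesgue_on \<Omega>. P \<le> p x"
    and P: "0 < P" and m: "0 \<le> m" "m \<le> 1" "ennreal m \<le> emeasure (lebesgue_on \<Omega>) A"
  shows "ennreal (m powr (1 / P)) \<le> var_norm \<Omega> p (indicator A)"
  unfolding var_norm_def
proof (rule INF_greatest, clarify)
  fix l :: real
  assume l: "0 < l" and le: "(\<integral>\<^sup>+x. ennreal ((\<bar>indicator A x\<bar> / l) powr p x) \<partial>lebesgue_on \<Omega>) \<le> 1"
  show "ennreal (m powr (1 / P)) \<le> ennreal l"
  proof (cases "1 \<le> l")
    case True
    have "m powr (1 / P) \<le> 1" using m P by (simp add: powr_le1)
    with True show ?thesis by (intro ennreal_leI) simp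
  next
    case False
    have "ennreal (l powr (- P) * m) \<le> ennreal (l powr (- P)) * emeasure (lebesgue_on \<Omega>) A"
      using m by (simp add: ennreal_mult mult_left_mono)
    also have "\<dots> = (\<integral>\<^sup>+x. ennreal (l powr (- P)) * indicator A x \<partial>lebesgue_on \<Omega>)"
      using A by (simp add: nn_integral_cmult_indicator)
    also have "\<dots> \<le> (\<integral>\<^sup>+x. ennreal ((\<bar>indicator A x\<bar> / l) powr p x) \<partial>lebesgue_on \<Omega>)"
      using p
    proof (intro nn_integral_mono_AE, eventually_elim)
      fix x assume "P \<le> p x"
      then have "l powr (- P) \<le> l powr (- p x)"
        using l False by (intro powr_mono') auto
      then show "ennreal (l powr (- P)) * indicator A x \<le> ennreal ((\<bar>indicator A x\<bar> / l) powr p x)"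
        using l by (auto simp: indicator_def powr_divide powr_minus_divide)
    qed
    also note le
    finally have "m \<le> l powr P"
      using l by (simp add: powr_minus field_simps)
    then have "m powr (1 / P) \<le> (l powr P) powr (1 / P)"
      using m P by (intro powr_mono2) auto
    then show ?thesis
      using l P by (intro ennreal_leI) (simp add: powr_powr)
  qed
qed

lemma lorentz_norm_ennreal:
  assumes "0 < r"
  shows "lorentz_norm \<Omega> p (ennreal r) f =
    epowr (\<integral>\<^sup>+u\<in>{0<..}. ennreal (u powr (r - 1)) *
      epowr (var_norm \<Omega> p (indicator {x\<in>\<Omega>. \<bar>f x\<bar> > u})) r \<partial>lborel) (1 / r)"
proof -
  have "ennreal (u powr r) * w / ennreal u = ennreal (u powr (r - 1)) * w" if "0 < u" for u w
  proof -
    have "ennreal (u powr r) * w / ennreal u = ennreal (u powr r) / ennreal u * w"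
      by (simp add: divide_ennreal_def mult_ac)
    also have "\<dots> = ennreal (u powr (r - 1)) * w"
      using that by (simp add: divide_ennreal powr_diff)
    finally show ?thesis .
  qed
  then show ?thesis
    using assms unfolding lorentz_norm_def
    by (auto simp: indicator_def intro!: arg_cong2[where f = epowr] nn_integral_cong)
qed

text \<open>Otherwise \<open>s\<close> would itself compete in the infimum. This passes from values
  of the rearrangement to level sets, on which the Lorentz quasi-norm is built.\<close>

lemma less_rearrangement_imp:
  assumes "0 < s" "ennreal s < rearrangement \<Omega> f t"
  shows "ennreal t < emeasure (lebesgue_on \<Omega>) {x\<in>\<Omega>. \<bar>f x\<bar> > s}"
proof (rule ccontr)
  assume "\<not> ?thesis"
  then have "rearrangement \<Omega> f t \<le> ennreal s"
    unfolding rearrangement_def using assms by (intro INF_lower) auto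
  with assms show False by simp
qed

lemma powr_has_deriv:
  fixes P t :: real
  assumes "0 < t"
  shows "((\<lambda>t. t powr (- 1 / P)) has_real_derivative (- 1 / P) * t powr (- 1 / P - 1)) (at t)"
  using assms by (auto intro!: derivative_eq_intros)

text \<open>For this \<open>\<Psi>\<close> the density \<open>- \<Psi>' / \<Psi>\<close> is
  \<open>1 / (P * t)\<close>. Absorbing \<open>\<Psi>\<close> into the weight leaves, up to a
  constant, the classical Lorentz quasi-norm with constant exponent \<open>P\<close> and second
  index \<open>v\<close>, restricted to \<open>t < \<epsilon>\<close>.\<close>

lemma envelope_functional_powr:
  assumes v: "0 < v" and P: "0 < P"
  shows "envelope_functional \<Omega> (\<lambda>t. t powr (- 1 / P)) \<epsilon> (ennreal v) f =
    epowr (\<integral>\<^sup>+t\<in>{0<..<\<epsilon>}. epowr (rearrangement \<Omega> f t) v *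
      ennreal (t powr (v / P - 1) / P) \<partial>lborel) (1 / v)"
proof -
  have "epowr (y / ennreal (t powr (- 1 / P))) v *
      ennreal (- deriv (\<lambda>t. t powr (- 1 / P)) t / t powr (- 1 / P)) =
      epowr y v * ennreal (t powr (v / P - 1) / P)" if t: "0 < t" for t y
  proof -
    have d: "- deriv (\<lambda>t. t powr (- 1 / P)) t / t powr (- 1 / P) = 1 / (P * t)"
      unfolding DERIV_imp_deriv[OF powr_has_deriv[OF t]] using t P by (simp add: powr_diff)
    have "epowr (y / ennreal (t powr (- 1 / P))) v = epowr y v / ennreal (t powr (- v / P))"
      using t v by (simp add: epowr_divide_ennreal powr_powr)
    also have "\<dots> = epowr y v * ennreal (t powr (v / P))"
      using t by (simp add: divide_ennreal_def inverse_ennreal powr_minus)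
    finally have "epowr (y / ennreal (t powr (- 1 / P))) v * ennreal (1 / (P * t)) =
        epowr y v * ennreal (t powr (v / P) * (1 / (P * t)))"
      using t P by (simp add: mult.assoc flip: ennreal_mult)
    also have "t powr (v / P) * (1 / (P * t)) = t powr (v / P - 1) / P"
      using t by (simp add: powr_diff)
    finally show ?thesis
      unfolding d .
  qed
  then show ?thesis
    using v unfolding envelope_functional_def
    by (auto simp: indicator_def intro!: arg_cong2[where f = epowr] nn_integral_cong)
qed

lemma level_set_measurable:
  fixes f :: "'a::euclidean_space \<Rightarrow> real"
  assumes "f \<in> borel_measurable (lebesgue_on \<Omega>)"
  shows "{x\<in>\<Omega>. \<bar>f x\<bar> > s} \<in> sets (lebesgue_on \<Omega>)"
proof -
  have "{x\<in>space (lebesgue_on \<Omega>). \<bar>f x\<bar> > s} \<in> sets (lebesgue_on \<Omega>)"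
    using assms by measurable
  then show ?thesis by simp
qed

text \<open>A weak-type estimate: the level sets below height \<open>u\<close> contain the one at
  \<open>u\<close>, so their indicators have quasi-norm at least \<open>t powr (1 / P)\<close>. For
  finite \<open>q = r\<close>, integrating \<open>s powr (r - 1)\<close> up to \<open>u\<close>
  gives \<open>u powr r / r\<close>, whence the constant \<open>r powr (1 / r)\<close>.\<close>

lemma lorentz_norm_ge:
  assumes f: "f \<in> borel_measurable (lebesgue_on \<Omega>)" and p: "AE x in lebesgue_on \<Omega>. P \<le> p x"
    and P: "0 < P" and q: "0 < q" and t: "0 \<le> t" "t \<le> 1" and u: "0 < u"
    and le: "ennreal t \<le> emeasure (lebesgue_on \<Omega>) {x\<in>\<Omega>. \<bar>f x\<bar> > u}"
  shows "ennreal (u * t powr (1 / P)) \<le>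
    ennreal (if q = \<infinity> then 1 else enn2real q powr (1 / enn2real q)) * lorentz_norm \<Omega> p q f"
proof -
  have meas: "{x\<in>\<Omega>. \<bar>f x\<bar> > s} \<in> sets (lebesgue_on \<Omega>)" for s
    by (rule level_set_measurable[OF f])
  have ge: "ennreal (t powr (1 / P)) \<le> var_norm \<Omega> p (indicator {x\<in>\<Omega>. \<bar>f x\<bar> > s})" if "s \<le> u" for s
  proof (rule var_norm_indicator_ge[OF meas p P t])
    show "ennreal t \<le> emeasure (lebesgue_on \<Omega>) {x\<in>\<Omega>. \<bar>f x\<bar> > s}"
      using that by (intro order.trans[OF le] emeasure_mono meas) auto
  qed
  show ?thesis
  proof (cases q)
    case top
    have "ennreal (u * t powr (1 / P)) \<le> ennreal u * var_norm \<Omega> p (indicator {x\<in>\<Omega>. \<bar>f x\<bar> > u})"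
      using u ge[of u] by (simp add: ennreal_mult mult_left_mono)
    also have "\<dots> \<le> lorentz_norm \<Omega> p q f"
      using top u unfolding lorentz_norm_def by (auto intro!: SUP_upper)
    finally show ?thesis using top by simp
  next
    case (real r)
    with q have r: "0 < r" by simp
    let ?w = "\<lambda>s. var_norm \<Omega> p (indicator {x\<in>\<Omega>. \<bar>f x\<bar> > s})"
    have "ennreal ((u * t powr (1 / P)) powr r / r) =
        ennreal (u powr r / r) * ennreal (t powr (r / P))"
      using u t r by (simp add: powr_mult powr_powr flip: ennreal_mult)
    also have "\<dots> = (\<integral>\<^sup>+s\<in>{0<..<u}. ennreal (s powr (r - 1)) * ennreal (t powr (r / P)) \<partial>lborel)"
      using r u by (subst nn_integral_powr_from_0[symmetric])
        (auto simp: mult_ac simp flip: nn_integral_cmult)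
    also have "\<dots> \<le> (\<integral>\<^sup>+s\<in>{0<..}. ennreal (s powr (r - 1)) * epowr (?w s) r \<partial>lborel)"
    proof (intro nn_integral_mono)
      fix s :: real
      show "ennreal (s powr (r - 1)) * ennreal (t powr (r / P)) * indicator {0<..<u} s
          \<le> ennreal (s powr (r - 1)) * epowr (?w s) r * indicator {0<..} s"
      proof (cases "s \<in> {0<..<u}")
        case True
        have "ennreal (t powr (r / P)) = epowr (ennreal (t powr (1 / P))) r"
          by (simp add: epowr_ennreal powr_powr)
        also have "\<dots> \<le> epowr (?w s) r"
          using True r by (intro epowr_mono ge) auto
        finally show ?thesis
          using True by (simp add: mult_left_mono)
      qed (simp add: indicator_def)
    qed
    finally have "epowr (ennreal ((u * t powr (1 / P)) powr r / r)) (1 / r) \<le> lorentz_norm \<Omega> p q f"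
      unfolding real lorentz_norm_ennreal[OF r] using r by (intro epowr_mono) auto
    moreover have "epowr (ennreal ((u * t powr (1 / P)) powr r / r)) (1 / r) =
        ennreal (u * t powr (1 / P) / r powr (1 / r))"
      using u t r by (simp add: epowr_ennreal powr_divide powr_powr)
    ultimately have "ennreal (r powr (1 / r)) * ennreal (u * t powr (1 / P) / r powr (1 / r)) \<le>
        ennreal (r powr (1 / r)) * lorentz_norm \<Omega> p q f"
      by (intro mult_left_mono) auto
    then show ?thesis
      using real r u t by (simp flip: ennreal_mult)
  qed
qed

text \<open>The weak-type estimate is applied at a level \<open>s\<close> strictly between the two
  sides, where the level set has measure above \<open>t\<close>. Such an \<open>s\<close> is finite
  even if the rearrangement is not.\<close>

lemma rearrangement_le_lorentz_norm:
  assumes f: "f \<in> borel_measurable (lebesgue_on \<Omega>)" and p: "AE x in lebesgue_on \<Omega>. P \<le> p x"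
    and P: "0 < P" and q: "0 < q" and t: "0 < t" "t \<le> 1"
  shows "rearrangement \<Omega> f t \<le>
    ennreal ((if q = \<infinity> then 1 else enn2real q powr (1 / enn2real q)) * t powr (- 1 / P)) * lorentz_norm \<Omega> p q f"
    (is "_ \<le> ennreal (?C * _) * ?N")
proof (rule ccontr)
  assume "\<not> ?thesis"
  then have "ennreal (?C * t powr (- 1 / P)) * ?N < rearrangement \<Omega> f t" by simp
  then obtain s' where s': "ennreal (?C * t powr (- 1 / P)) * ?N < s'" "s' < rearrangement \<Omega> f t"
    using dense by blast
  then have "s' < top" by (auto simp: less_top[symmetric] top_unique)
  then obtain s where s: "s' = ennreal s" "0 \<le> s" by (cases s') auto
  with s' have "0 < s"
    by (metis ennreal_0 le_less not_less_zero)
  then have "ennreal t \<le> emeasure (lebesgue_on \<Omega>) {x\<in>\<Omega>. \<bar>f x\<bar> > s}"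
    using less_rearrangement_imp[of s \<Omega> f t] s s' by simp
  then have "ennreal (s * t powr (1 / P)) \<le> ennreal ?C * ?N"
    using lorentz_norm_ge[OF f p P q, of t s] t \<open>0 < s\<close> by simp
  then have "ennreal (t powr (- 1 / P)) * ennreal (s * t powr (1 / P)) \<le>
      ennreal (t powr (- 1 / P)) * (ennreal ?C * ?N)"
    by (intro mult_left_mono) auto
  moreover have "ennreal (t powr (- 1 / P)) * ennreal (s * t powr (1 / P)) = ennreal s"
    using t \<open>0 < s\<close> by (simp add: powr_minus field_simps flip: ennreal_mult)
  moreover have "ennreal (t powr (- 1 / P)) * (ennreal ?C * ?N) = ennreal (?C * t powr (- 1 / P)) * ?N"
    by (subst ennreal_mult) (auto simp: mult_ac)
  ultimately show False using s' s by simp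
qed

text \<open>The power of the rearrangement is written as an integral over levels \<open>u\<close>; a
  level below the rearrangement at \<open>t\<close> forces \<open>t < m u\<close>. After exchanging
  the integrals, the inner one is a power of \<open>min 1 (m u)\<close>, which the indicator bound
  compares with the Lorentz integrand. The condition \<open>\<epsilon> \<le> 1\<close> matches the
  cap in that bound.\<close>

lemma envelope_functional_le_lorentz_norm:
  assumes \<Omega>: "\<Omega> \<in> sets lebesgue" "emeasure lebesgue \<Omega> < \<infinity>"
    and f: "f \<in> borel_measurable (lebesgue_on \<Omega>)" and p: "AE x in lebesgue_on \<Omega>. P \<le> p x"
    and P: "0 < P" and r: "0 < r" and \<epsilon>: "\<epsilon> \<le> 1"
  shows "envelope_functional \<Omega> (\<lambda>t. t powr (- 1 / P)) \<epsilon> (ennreal r) f \<le> lorentz_norm \<Omega> p (ennreal r) f"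
proof -
  let ?w = "\<lambda>s. var_norm \<Omega> p (indicator {x\<in>\<Omega>. \<bar>f x\<bar> > s})"
  define m where "m s = measure (lebesgue_on \<Omega>) {x\<in>\<Omega>. \<bar>f x\<bar> > s}" for s
  interpret finite_measure "lebesgue_on \<Omega>"
    using \<Omega> by (intro finite_measureI) (auto simp: emeasure_restrict_space)
  have meas: "{x\<in>\<Omega>. \<bar>f x\<bar> > s} \<in> sets (lebesgue_on \<Omega>)" for s
    by (rule level_set_measurable[OF f])
  \<comment> \<open>Finite measure makes the distribution function \<open>m\<close> real-valued and
    monotonicity makes it Borel, as the exchange of integrals requires.\<close>
  have "mono (\<lambda>s. - m s)"
    unfolding m_def by (auto intro!: monoI finite_measure_mono meas)
  then have "(\<lambda>s. - (- m s)) \<in> borel_measurable borel"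
    by (intro borel_measurable_uminus borel_measurable_mono)
  then have [measurable]: "m \<in> borel_measurable borel" by simp
  have m_nonneg: "0 \<le> m s" for s by (simp add: m_def)
  have em: "emeasure (lebesgue_on \<Omega>) {x\<in>\<Omega>. \<bar>f x\<bar> > s} = ennreal (m s)" for s
    by (simp add: m_def emeasure_eq_measure)
  \<comment> \<open>The region is described by \<open>t < m u\<close> rather than by the
    rearrangement, so joint measurability follows from that of \<open>m\<close>. The two factors are
    the layer-cake density in \<open>u\<close> and the weight in \<open>t\<close>.\<close>
  let ?k = "\<lambda>(t, u). ennreal (r * u powr (r - 1)) * ennreal (t powr (r / P - 1) / P) *
      indicator {(t, u). 0 < t \<and> t < 1 \<and> t < m u \<and> 0 < u} (t, u)"
  have [measurable]: "?k \<in> borel_measurable (lborel \<Otimes>\<^sub>M lborel)"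
    by measurable
  have "(\<integral>\<^sup>+t\<in>{0<..<\<epsilon>}. epowr (rearrangement \<Omega> f t) r * ennreal (t powr (r / P - 1) / P) \<partial>lborel)
      \<le> (\<integral>\<^sup>+t. \<integral>\<^sup>+u. ?k (t, u) \<partial>lborel \<partial>lborel)"
  proof (intro nn_integral_mono)
    fix t :: real
    let ?c = "ennreal (t powr (r / P - 1) / P) * indicator {0<..<\<epsilon>} t"
    have "epowr (rearrangement \<Omega> f t) r * ennreal (t powr (r / P - 1) / P) * indicator {0<..<\<epsilon>} t =
        (\<integral>\<^sup>+u. ennreal (r * u powr (r - 1)) * indicator {u. 0 < u \<and> ennreal u < rearrangement \<Omega> f t} u * ?c \<partial>lborel)"
      by (subst nn_integral_multc) (auto simp: epowr_eq_nn_integral[OF r] mult_ac)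
    also have "\<dots> \<le> (\<integral>\<^sup>+u. ?k (t, u) \<partial>lborel)"
    proof (intro nn_integral_mono)
      fix u :: real
      have "t < m u" if "0 < t" "0 < u" "ennreal u < rearrangement \<Omega> f t"
        using less_rearrangement_imp[OF that(2,3)] that(1) by (simp add: em ennreal_less_iff)
      then show "ennreal (r * u powr (r - 1)) * indicator {u. 0 < u \<and> ennreal u < rearrangement \<Omega> f t} u * ?c
          \<le> ?k (t, u)"
        using \<epsilon> by (auto simp: indicator_def mult_ac)
    qed
    finally show "epowr (rearrangement \<Omega> f t) r * ennreal (t powr (r / P - 1) / P) * indicator {0<..<\<epsilon>} t
        \<le> (\<integral>\<^sup>+u. ?k (t, u) \<partial>lborel)" .
  qed
  also have "\<dots> = (\<integral>\<^sup>+u. \<integral>\<^sup>+t. ?k (t, u) \<partial>lborel \<partial>lborel)"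
    by (rule lborel_pair.Fubini') measurable
  also have "\<dots> \<le> (\<integral>\<^sup>+u\<in>{0<..}. ennreal (u powr (r - 1)) * epowr (?w u) r \<partial>lborel)"
  proof (intro nn_integral_mono)
    fix u :: real
    show "(\<integral>\<^sup>+t. ?k (t, u) \<partial>lborel) \<le> ennreal (u powr (r - 1)) * epowr (?w u) r * indicator {0<..} u"
    proof (cases "0 < u")
      case True
      have "(\<integral>\<^sup>+t. ?k (t, u) \<partial>lborel) =
          (\<integral>\<^sup>+t. ennreal (r * u powr (r - 1) / P) *
            (ennreal (t powr (r / P - 1)) * indicator {0<..<min 1 (m u)} t) \<partial>lborel)"
        using True r P by (intro nn_integral_cong) (auto simp: indicator_def simp flip: ennreal_mult)
      also have "\<dots> = ennreal (r * u powr (r - 1) / P) * ennreal (min 1 (m u) powr (r / P) / (r / P))"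
        using r P m_nonneg[of u] by (subst nn_integral_cmult) (auto simp: nn_integral_powr_from_0)
      \<comment> \<open>The factor \<open>r / P\<close> cancels the denominator produced by the
        \<open>t\<close>-integral, so the final constant is exactly 1.\<close>
      also have "\<dots> = ennreal (u powr (r - 1)) * ennreal (min 1 (m u) powr (r / P))"
        using r P by (simp flip: ennreal_mult)
      also have "ennreal (min 1 (m u) powr (r / P)) = epowr (ennreal (min 1 (m u) powr (1 / P))) r"
        by (simp add: epowr_ennreal powr_powr)
      also have "\<dots> \<le> epowr (?w u) r"
        using r m_nonneg[of u]
        by (intro epowr_mono var_norm_indicator_ge[OF meas p P]) (auto simp: em intro!: ennreal_leI)
      finally show ?thesis
        using True by (simp add: mult_left_mono)
    qed simp
  qed
  finally show ?thesis
    unfolding envelope_functional_powr[OF r P] lorentz_norm_ennreal[OF r]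
    using r by (intro epowr_mono) auto
qed

section \<open>Quasi-norms of indicators of balls about \<open>x0\<close>\<close>

lemma emeasure_lebesgue_on_ball:
  fixes x0 :: "'a::euclidean_space"
  assumes "\<Omega> \<in> sets lebesgue" "ball x0 r \<subseteq> \<Omega>" "0 < r"
  shows "emeasure (lebesgue_on \<Omega>) (ball x0 r) = ennreal (unit_ball_vol DIM('a) * r powr DIM('a))"
  using assms by (simp add: emeasure_restrict_space emeasure_ball powr_realpow)

lemma var_norm_le:
  assumes "0 < l" "(\<integral>\<^sup>+x. ennreal ((\<bar>f x\<bar> / l) powr p x) \<partial>lebesgue_on \<Omega>) \<le> 1"
  shows "var_norm \<Omega> p f \<le> ennreal l"
  unfolding var_norm_def using assms by (intro INF_lower) auto

lemma var_norm_indicator_empty: "var_norm \<Omega> p (indicator {}) = 0"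
proof (rule ccontr)
  assume "var_norm \<Omega> p (indicator {}) \<noteq> 0"
  then obtain l where l: "0 < l" "l < var_norm \<Omega> p (indicator {})"
    using dense[of 0 "var_norm \<Omega> p (indicator {})"] by (auto simp: zero_less_iff_neq_zero)
  then have "l < top" by (auto simp: less_top[symmetric] top_unique)
  with l obtain l' where l': "0 < l'" "l = ennreal l'"
    by (cases l) (auto simp: ennreal_less_zero_iff)
  have "var_norm \<Omega> p (indicator {}) \<le> ennreal l'"
    using l' by (intro var_norm_le) auto
  with l l' show False by simp
qed

text \<open>The candidate \<open>K * r powr (d / P)\<close> is tested in the modular. Inside the
  ball, log-Hoelder continuity gives \<open>(p x - P) * (- ln r) \<le> C\<close>, so replacing
  \<open>p x\<close> by \<open>P\<close> costs a bounded factor. The integrand is then at most the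
  reciprocal of the volume of the ball.\<close>

lemma var_norm_indicator_ball_le:
  fixes x0 :: "'a::euclidean_space"
  assumes \<Omega>: "open \<Omega>" "x0 \<in> \<Omega>" and P: "0 < p x0" "AE x in lebesgue_on \<Omega>. p x0 \<le> p x"
    and lh: "log_Hoelder_at \<Omega> x0 p"
  obtains K \<rho> where "0 < K" "0 < \<rho>" "ball x0 \<rho> \<subseteq> \<Omega>"
    "\<And>r. 0 < r \<Longrightarrow> r \<le> \<rho> \<Longrightarrow> var_norm \<Omega> p (indicator (ball x0 r)) \<le> ennreal (K * r powr (DIM('a) / p x0))"
proof -
  let ?\<omega> = "unit_ball_vol (real DIM('a))" and ?d = "real DIM('a)" and ?P = "p x0"
  have \<omega>: "0 < ?\<omega>" by simp
  then have \<omega>0: "?\<omega> \<noteq> 0" by linarith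
  have \<Omega>_meas: "\<Omega> \<in> sets lebesgue" using \<Omega> by (simp add: borel_open)
  obtain C where C: "0 < C"
    "\<And>x. x \<in> \<Omega> \<Longrightarrow> norm (x - x0) < 1/2 \<Longrightarrow> \<bar>p x - ?P\<bar> \<le> C / (- ln (norm (x - x0)))"
    using lh unfolding log_Hoelder_at_def by blast
  obtain \<rho>' where \<rho>': "0 < \<rho>'" "ball x0 \<rho>' \<subseteq> \<Omega>"
    using \<Omega> openE by blast
  \<comment> \<open>The bound 1/2 keeps the ball within reach of the log-Hoelder condition and makes
    \<open>- ln r\<close> positive.\<close>
  define \<rho> where "\<rho> = min \<rho>' (1/2)"
  \<comment> \<open>The second entry makes \<open>K powr ?P\<close> absorb both the unit-ball volume
    and the log-Hoelder factor; the first makes \<open>K powr (- p x)\<close> at most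
    \<open>K powr (- ?P)\<close>.\<close>
  define K where "K = max 1 ((?\<omega> * exp (?d * C / ?P)) powr (1 / ?P))"
  have K: "1 \<le> K" by (simp add: K_def)
  have "?\<omega> * exp (?d * C / ?P) = ((?\<omega> * exp (?d * C / ?P)) powr (1 / ?P)) powr ?P"
    using P by (simp add: powr_powr)
  also have "\<dots> \<le> K powr ?P"
    using P by (intro powr_mono2) (auto simp: K_def)
  finally have KP: "?\<omega> * exp (?d * C / ?P) \<le> K powr ?P" .
  have "var_norm \<Omega> p (indicator (ball x0 r)) \<le> ennreal (K * r powr (?d / ?P))"
    if r: "0 < r" "r \<le> \<rho>" for r
  proof (rule var_norm_le)
    let ?l = "K * r powr (?d / ?P)"
    show l: "0 < ?l" using K r by simp
    have r12: "r \<le> 1/2" and sub: "ball x0 r \<subseteq> \<Omega>"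
      using r \<rho>' by (auto simp: \<rho>_def)
    have lnr: "0 < - ln r" using r r12 by (simp add: ln_less_zero)
    have pw: "(1 / ?l) powr p x \<le> 1 / (?\<omega> * r powr ?d)" if x: "x \<in> ball x0 r" and px: "?P \<le> p x" for x
    proof -
      have "(p x - ?P) * (- ln r) \<le> C"
      proof (cases "x = x0")
        case False
        then have n: "0 < norm (x - x0)" "norm (x - x0) < r"
          using x by (auto simp: dist_norm norm_minus_commute)
        have "p x - ?P \<le> C / (- ln (norm (x - x0)))"
          using C(2)[of x] x sub n r12 by auto
        \<comment> \<open>Both logarithms are negative, so enlarging the distance to
          \<open>r\<close> shrinks the denominator.\<close>
        also have "\<dots> \<le> C / (- ln r)"
          using n r lnr C(1) by (intro divide_left_mono mult_pos_pos) (auto simp: ln_less_zero)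
        finally show ?thesis using lnr by (simp add: field_simps)
      qed (use C in simp)
      then have "?d / ?P * ((p x - ?P) * (- ln r)) \<le> ?d / ?P * C"
        using P by (intro mult_left_mono) auto
      moreover have "- (?d / ?P * (p x - ?P)) * ln r = ?d / ?P * ((p x - ?P) * (- ln r))"
        by (simp only: mult.assoc mult_minus_left mult_minus_right)
      ultimately have "- (?d / ?P * (p x - ?P)) * ln r \<le> ?d * C / ?P"
        by (simp only: times_divide_eq_left)
      then have "r powr (- (?d / ?P * (p x - ?P))) \<le> exp (?d * C / ?P)"
        using r by (simp add: powr_def del: mult_minus_left)
      moreover have "K powr (- p x) \<le> K powr (- ?P)"
        using K px by (intro powr_mono) auto
      ultimately have "K powr (- p x) * (r powr (- (?d / ?P * (p x - ?P))) * r powr (- ?d)) \<le>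
          K powr (- ?P) * (exp (?d * C / ?P) * r powr (- ?d))"
        by (intro mult_mono mult_right_mono) auto
      \<comment> \<open>Splitting \<open>p x\<close> as \<open>?P + (p x - ?P)\<close> separates
        \<open>r powr (- ?d)\<close>, which matches the volume, from the factor controlled by
        log-Hoelder continuity.\<close>
      moreover have "(1 / ?l) powr p x = K powr (- p x) * (r powr (- (?d / ?P * (p x - ?P))) * r powr (- ?d))"
      proof -
        have "- (?d / ?P * (p x - ?P)) + - ?d = - (?d / ?P * p x)"
          using P by (simp add: field_simps)
        then have "r powr (- (?d / ?P * (p x - ?P))) * r powr (- ?d) = r powr (- (?d / ?P * p x))"
          by (simp only: powr_add[symmetric])
        moreover have "(1 / ?l) powr p x = K powr (- p x) * r powr (- (?d / ?P * p x))"
          using K r by (simp add: powr_divide powr_mult powr_powr powr_minus divide_simps)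
        ultimately show ?thesis by simp
      qed
      moreover have "K powr (- ?P) * (exp (?d * C / ?P) * r powr (- ?d)) \<le> 1 / (?\<omega> * r powr ?d)"
        using KP K r \<omega> by (simp add: powr_minus field_simps)
      ultimately show ?thesis by linarith
    qed
    have "(\<integral>\<^sup>+x. ennreal ((\<bar>indicator (ball x0 r) x\<bar> / ?l) powr p x) \<partial>lebesgue_on \<Omega>) \<le>
        (\<integral>\<^sup>+x. ennreal (1 / (?\<omega> * r powr ?d)) * indicator (ball x0 r) x \<partial>lebesgue_on \<Omega>)"
      using P(2)
    proof (intro nn_integral_mono_AE, eventually_elim)
      fix x assume "?P \<le> p x"
      then show "ennreal ((\<bar>indicator (ball x0 r) x\<bar> / ?l) powr p x) \<le>
          ennreal (1 / (?\<omega> * r powr ?d)) * indicator (ball x0 r) x"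
        using pw[of x] by (cases "x \<in> ball x0 r") (auto intro!: ennreal_leI)
    qed
    also have "\<dots> = ennreal (1 / (?\<omega> * r powr ?d)) * emeasure (lebesgue_on \<Omega>) (ball x0 r)"
      using sub \<Omega>_meas
      by (intro nn_integral_cmult_indicator) (auto simp: sets_restrict_space_iff)
    also have "\<dots> = 1"
      using r \<omega>0 by (simp add: emeasure_lebesgue_on_ball[OF \<Omega>_meas sub] flip: ennreal_mult)
    finally show "(\<integral>\<^sup>+x. ennreal ((\<bar>indicator (ball x0 r) x\<bar> / ?l) powr p x) \<partial>lebesgue_on \<Omega>) \<le> 1" .
  qed
  then show thesis
    using K \<rho>' by (intro that[of K \<rho>]) (auto simp: \<rho>_def)
qed

section \<open>Truncated powers as test functions\<close>

text \<open>A radial power about \<open>x0\<close>, flattened within distance \<open>R\<close> and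
  cut off outside radius \<open>\<rho>\<close>. The flattening keeps the logarithm in its Lorentz
  norm finite; the cutoff confines it to balls whose indicators are controlled.\<close>

definition peak :: "'a::euclidean_space \<Rightarrow> real \<Rightarrow> real \<Rightarrow> real \<Rightarrow> real \<Rightarrow> 'a \<Rightarrow> real"
  where "peak x0 b c R \<rho> x = c * max (norm (x - x0)) R powr (- b) * indicator (ball x0 \<rho>) x"

lemma peak_measurable [measurable]: "peak x0 b c R \<rho> \<in> borel_measurable (lebesgue_on \<Omega>)"
proof -
  have [measurable]: "ball x0 \<rho> \<in> sets borel" by simp
  have "peak x0 b c R \<rho> \<in> borel_measurable borel"
    unfolding peak_def by (measurable; simp)
  then have "peak x0 b c R \<rho> \<in> borel_measurable lebesgue"
    by (simp add: measurable_completion)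
  then show ?thesis by (rule measurable_restrict_space1)
qed

lemma less_powr_minus_iff:
  fixes y z b :: real
  assumes "0 < y" "0 < z" "0 < b"
  shows "z < y powr (- b) \<longleftrightarrow> y < z powr (- 1 / b)"
proof -
  have "z < y powr (- b) \<longleftrightarrow> ln z < - b * ln y"
    using assms by (metis exp_gt_zero ln_less_cancel_iff ln_powr powr_gt_zero less_irrefl)
  also have "\<dots> \<longleftrightarrow> ln y < - 1 / b * ln z"
    using assms by (auto simp: field_simps)
  also have "\<dots> \<longleftrightarrow> y < z powr (- 1 / b)"
    using assms by (metis exp_gt_zero ln_less_cancel_iff ln_powr powr_gt_zero less_irrefl)
  finally show ?thesis .
qed

text \<open>Below the maximal height \<open>c * R powr (- b)\<close> the level radius exceeds
  \<open>R\<close>, so the flattening does not show and the level set is a full ball; at or above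
  that height nothing is left.\<close>

lemma peak_level_set:
  assumes "ball x0 \<rho> \<subseteq> \<Omega>" "0 < b" "0 < c" "0 < R" "0 < u"
  shows "{x\<in>\<Omega>. \<bar>peak x0 b c R \<rho> x\<bar> > u} =
    (if u < c * R powr (- b) then ball x0 (min \<rho> ((u / c) powr (- 1 / b))) else {})"
proof -
  have R: "u < c * R powr (- b) \<longleftrightarrow> R < (u / c) powr (- 1 / b)"
    using assms less_powr_minus_iff[of R "u / c" b] by (simp add: field_simps)
  have "u < \<bar>peak x0 b c R \<rho> x\<bar> \<longleftrightarrow>
      x \<in> ball x0 \<rho> \<and> norm (x - x0) < (u / c) powr (- 1 / b) \<and> R < (u / c) powr (- 1 / b)" for x
  proof -
    have "u < c * max (norm (x - x0)) R powr (- b) \<longleftrightarrow> max (norm (x - x0)) R < (u / c) powr (- 1 / b)"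
      using assms less_powr_minus_iff[of "max (norm (x - x0)) R" "u / c" b] by (simp add: field_simps)
    then show ?thesis
      using assms by (cases "x \<in> ball x0 \<rho>") (simp_all add: peak_def abs_mult)
  qed
  with assms R show ?thesis
    by (auto simp: dist_norm norm_minus_commute)
qed

context
  fixes \<Omega> :: "'a::euclidean_space set" and p :: "'a \<Rightarrow> real" and x0 :: 'a and P K \<rho>0 b :: real
  assumes \<Omega>: "\<Omega> \<in> sets lebesgue" and P: "0 < P" and K: "0 < K" and \<rho>0: "ball x0 \<rho>0 \<subseteq> \<Omega>"
    and ball_le: "\<And>r. 0 < r \<Longrightarrow> r \<le> \<rho>0 \<Longrightarrow> var_norm \<Omega> p (indicator (ball x0 r)) \<le> ennreal (K * r powr (DIM('a) / P))"
  defines "b \<equiv> DIM('a) / P"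
begin

lemma b_pos: "0 < b"
  using P by (simp add: b_def)

text \<open>Since \<open>b\<close> is the exponent in the ball bound, the level radius
  \<open>(u / c) powr (- 1 / b)\<close> raised to it is exactly \<open>c / u\<close>.\<close>

lemma var_norm_peak_level_le:
  assumes "0 < c" "0 < R" "R \<le> \<rho>" "\<rho> \<le> \<rho>0" "0 < u"
  shows "var_norm \<Omega> p (indicator {x\<in>\<Omega>. \<bar>peak x0 b c R \<rho> x\<bar> > u}) \<le>
    (if u < c * R powr (- b) then ennreal (K * min (\<rho> powr b) (c / u)) else 0)"
proof -
  have sub: "ball x0 \<rho> \<subseteq> \<Omega>" using assms \<rho>0 by auto
  have "min \<rho> ((u / c) powr (- 1 / b)) powr b \<le> min (\<rho> powr b) (c / u)"
  proof -
    have "((u / c) powr (- 1 / b)) powr b = (u / c) powr (- 1)"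
      using b_pos by (simp add: powr_powr)
    also have "\<dots> = c / u"
      using assms by (simp add: powr_minus)
    finally have "((u / c) powr (- 1 / b)) powr b = c / u" .
    moreover have "min \<rho> y powr b \<le> min (\<rho> powr b) (y powr b)" if "0 \<le> y" for y
      using assms b_pos that by (auto intro!: powr_mono2)
    ultimately show ?thesis
      by (metis powr_ge_zero)
  qed
  then have "ennreal (K * min \<rho> ((u / c) powr (- 1 / b)) powr b) \<le> ennreal (K * min (\<rho> powr b) (c / u))"
    using K by (intro ennreal_leI mult_left_mono) auto
  moreover have "var_norm \<Omega> p (indicator (ball x0 (min \<rho> ((u / c) powr (- 1 / b))))) \<le>
      ennreal (K * min \<rho> ((u / c) powr (- 1 / b)) powr b)"
    using assms unfolding b_def by (intro ball_le) auto
  ultimately show ?thesis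
    unfolding peak_level_set[OF sub b_pos assms(1,2,5)]
    by (auto simp: var_norm_indicator_empty intro: order.trans)
qed

text \<open>For \<open>q = \<infinity>\<close> the exponent \<open>1 / enn2real q\<close> is \<open>1 / 0 = 0\<close>, as it should be.\<close>

lemma lorentz_norm_peak_le:
  assumes "0 < c" "0 < R" "R \<le> \<rho>" "\<rho> \<le> \<rho>0" "1 \<le> q"
  shows "lorentz_norm \<Omega> p q (peak x0 b c R \<rho>) \<le>
    ennreal (c * K * (1 + b * ln (\<rho> / R)) powr (1 / enn2real q))"
proof (cases q)
  case top
  have ln: "0 \<le> b * ln (\<rho> / R)" using assms b_pos by simp
  have "ennreal u * var_norm \<Omega> p (indicator {x\<in>\<Omega>. \<bar>peak x0 b c R \<rho> x\<bar> > u}) \<le> ennreal (c * K)"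
    if "0 < u" for u
  proof -
    have "ennreal u * var_norm \<Omega> p (indicator {x\<in>\<Omega>. \<bar>peak x0 b c R \<rho> x\<bar> > u}) \<le>
        ennreal u * ennreal (K * (c / u))"
    proof (intro mult_left_mono order.trans[OF var_norm_peak_level_le[OF assms(1-4) that]])
      have "K * min (\<rho> powr b) (c / u) \<le> K * (c / u)"
        using K by (intro mult_left_mono) auto
      then show "(if u < c * R powr (- b) then ennreal (K * min (\<rho> powr b) (c / u)) else 0) \<le>
          ennreal (K * (c / u))"
        by (auto intro: ennreal_leI)
    qed simp
    also have "\<dots> = ennreal (c * K)"
      using that K assms by (simp flip: ennreal_mult)
    finally show ?thesis .
  qed
  then show ?thesis
    using top ln by (auto simp: lorentz_norm_def intro!: SUP_least)
next
  case (real r)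
  then have r: "1 \<le> r" using assms by simp
  have \<rho>: "0 < \<rho>" using assms by simp
  have ln: "0 \<le> b * ln (\<rho> / R)" using assms b_pos by simp
  let ?w = "\<lambda>u. var_norm \<Omega> p (indicator {x\<in>\<Omega>. \<bar>peak x0 b c R \<rho> x\<bar> > u})"
  \<comment> \<open>Below \<open>?s\<close> the level set is the whole ball of radius
    \<open>\<rho>\<close>. From \<open>?s\<close> to \<open>?S\<close> the bound
    \<open>K * (c / u)\<close> makes the integrand a multiple of \<open>1 / u\<close>, which yields
    the logarithm. Above \<open>?S\<close> the level sets are empty.\<close>
  let ?s = "c * \<rho> powr (- b)" and ?S = "c * R powr (- b)"
  have sS: "0 < ?s" "?s \<le> ?S"
    using assms b_pos by (auto intro!: powr_mono2')
  have "(\<integral>\<^sup>+u\<in>{0<..}. ennreal (u powr (r - 1)) * epowr (?w u) r \<partial>lborel) \<le>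
      (\<integral>\<^sup>+u. ennreal ((K * \<rho> powr b) powr r) * (ennreal (u powr (r - 1)) * indicator {0<..<?s} u) +
        ennreal ((c * K) powr r) * (ennreal (1 / u) * indicator {?s..?S} u) \<partial>lborel)"
  proof (intro nn_integral_mono)
    fix u :: real
    let ?R = "ennreal ((K * \<rho> powr b) powr r) * (ennreal (u powr (r - 1)) * indicator {0<..<?s} u) +
        ennreal ((c * K) powr r) * (ennreal (1 / u) * indicator {?s..?S} u)"
    consider "u \<le> 0" | "0 < u" "u < ?s" | "0 < u" "?s \<le> u" "u < ?S" | "0 < u" "?S \<le> u" by linarith
    then show "ennreal (u powr (r - 1)) * epowr (?w u) r * indicator {0<..} u \<le> ?R"
    proof cases
      case 1 then show ?thesis by simp
    next
      case 2
      have "K * min (\<rho> powr b) (c / u) \<le> K * \<rho> powr b"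
        using K by (intro mult_left_mono) auto
      with 2 sS have "?w u \<le> ennreal (K * \<rho> powr b)"
        using var_norm_peak_level_le[OF assms(1-4) 2(1)] by (auto intro: order.trans ennreal_leI)
      then have "epowr (?w u) r \<le> ennreal ((K * \<rho> powr b) powr r)"
        using epowr_mono[of _ _ r] r K by (fastforce simp: epowr_ennreal)
      with 2 show ?thesis by (simp add: mult.commute mult_left_mono)
    next
      case 3
      have "K * min (\<rho> powr b) (c / u) \<le> K * (c / u)"
        using K by (intro mult_left_mono) auto
      with 3 have "?w u \<le> ennreal (K * (c / u))"
        using var_norm_peak_level_le[OF assms(1-4) 3(1)] by (auto intro: order.trans ennreal_leI)
      then have "epowr (?w u) r \<le> ennreal ((K * (c / u)) powr r)"
        using epowr_mono[of _ _ r] r K 3 assms by (fastforce simp: epowr_ennreal)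
      then have "ennreal (u powr (r - 1)) * epowr (?w u) r \<le>
          ennreal (u powr (r - 1)) * ennreal ((K * (c / u)) powr r)"
        by (intro mult_left_mono) auto
      also have "\<dots> = ennreal ((c * K) powr r) * ennreal (1 / u)"
        using 3 K assms by (simp add: powr_mult powr_divide powr_diff mult_ac flip: ennreal_mult)
      finally show ?thesis using 3 by simp
    next
      case 4
      then have "?w u = 0"
        using var_norm_peak_level_le[OF assms(1-4), of u] by simp
      then have "epowr (?w u) r = 0"
        using r by (simp add: epowr_def)
      then show ?thesis by simp
    qed
  qed
  also have "\<dots> = ennreal ((K * \<rho> powr b) powr r) * ennreal (?s powr r / r) +
      ennreal ((c * K) powr r) * ennreal (ln ?S - ln ?s)"
    using sS r by (subst nn_integral_add) (auto simp: nn_integral_cmult nn_integral_powr_from_0 nn_integral_inverse_Icc)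
  also have "\<dots> = ennreal ((c * K) powr r * (1 / r + b * ln (\<rho> / R)))"
  proof -
    have "ln ?S - ln ?s = b * ln (\<rho> / R)"
      using assms \<rho> by (simp add: ln_mult ln_div ln_powr algebra_simps)
    moreover have "(K * \<rho> powr b) powr r * (?s powr r / r) = (c * K) powr r * (1 / r)"
    proof -
      have "\<rho> powr b * \<rho> powr (- b) = 1"
        using \<rho> by (simp flip: powr_add)
      then have "(K * \<rho> powr b) * ?s = c * K" by simp
      moreover have "(K * \<rho> powr b) powr r * ?s powr r = ((K * \<rho> powr b) * ?s) powr r"
        using K sS by (subst powr_mult) auto
      ultimately have "(K * \<rho> powr b) powr r * ?s powr r = (c * K) powr r"
        by (simp only:)
      then show ?thesis by simp
    qed
    ultimately show ?thesis
      using r ln by (simp add: distrib_left flip: ennreal_mult ennreal_plus)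
  qed
  \<comment> \<open>Here \<open>1 \<le> q\<close> is used to replace \<open>1 / r\<close> by
    1.\<close>
  also have "\<dots> \<le> ennreal ((c * K) powr r * (1 + b * ln (\<rho> / R)))"
    using r by (intro ennreal_leI mult_left_mono) auto
  finally have "lorentz_norm \<Omega> p q (peak x0 b c R \<rho>) \<le>
      epowr (ennreal ((c * K) powr r * (1 + b * ln (\<rho> / R)))) (1 / r)"
    using r unfolding real by (subst lorentz_norm_ennreal) (auto intro!: epowr_mono)
  also have "\<dots> = ennreal (c * K * (1 + b * ln (\<rho> / R)) powr (1 / r))"
    using r K ln assms by (simp add: epowr_ennreal powr_mult powr_powr)
  finally show ?thesis using real r by simp
qed

text \<open>For \<open>t\<close> between the volumes of the balls of radii \<open>R\<close> and
  \<open>\<rho>\<close>, neither the flattening nor the cutoff matters, and the rearrangement is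
  bounded below as for the pure power.\<close>

lemma rearrangement_peak_ge:
  fixes t :: real
  defines "\<omega> \<equiv> unit_ball_vol DIM('a)"
  assumes "0 < c" "0 < R" "R \<le> \<rho>" "\<rho> \<le> \<rho>0"
    and t: "\<omega> * R powr DIM('a) \<le> t" "t < \<omega> * \<rho> powr DIM('a)"
  shows "ennreal (c * (\<omega> / t) powr (1 / P)) \<le> rearrangement \<Omega> (peak x0 b c R \<rho>) t"
  unfolding rearrangement_def
proof (rule INF_greatest, clarify)
  fix s :: real
  assume s: "0 < s"
    and le: "emeasure (lebesgue_on \<Omega>) {x\<in>\<Omega>. \<bar>peak x0 b c R \<rho> x\<bar> > s} \<le> ennreal t"
  have \<omega>: "0 < \<omega>" by (simp add: \<omega>_def)
  have "0 < \<omega> * R powr DIM('a)" using \<omega> assms by simp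
  with t have t0: "0 < t" by linarith
  have sub: "ball x0 \<rho> \<subseteq> \<Omega>" using assms \<rho>0 by auto
  show "ennreal (c * (\<omega> / t) powr (1 / P)) \<le> ennreal s"
  proof (cases "s < c * R powr (- b)")
    \<comment> \<open>A level at or above the maximal height is large enough because the ball of
      radius \<open>R\<close> has volume at most \<open>t\<close>.\<close>
    case False
    have "(\<omega> / t) powr (1 / P) \<le> (R powr (- DIM('a))) powr (1 / P)"
      using t t0 \<omega> P assms by (intro powr_mono2) (auto simp: powr_minus field_simps)
    also have "\<dots> = R powr (- b)"
      by (simp add: powr_powr b_def)
    finally have "c * (\<omega> / t) powr (1 / P) \<le> c * R powr (- b)"
      using assms by simp
    with False show ?thesis by (intro ennreal_leI) simp
  next
    case True
    let ?m = "min \<rho> ((s / c) powr (- 1 / b))"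
    have m: "0 < ?m" "ball x0 ?m \<subseteq> \<Omega>" using assms s sub by auto
    have "\<omega> * ?m powr DIM('a) \<le> t"
      using le True t0 emeasure_lebesgue_on_ball[OF \<Omega> m(2,1)]
      unfolding peak_level_set[OF sub b_pos assms(2,3) s] \<omega>_def
      by simp
    \<comment> \<open>If the minimum were \<open>\<rho>\<close>, the volume would exceed
      \<open>t\<close>; so the cutoff is inactive.\<close>
    with t have "?m = (s / c) powr (- 1 / b)" and "\<omega> * ?m powr DIM('a) \<le> t"
      by (auto simp: min_def)
    then have "\<omega> * ((s / c) powr (- 1 / b)) powr DIM('a) \<le> t" by simp
    moreover have "((s / c) powr (- 1 / b)) powr DIM('a) = (s / c) powr (- P)"
      by (simp add: powr_powr b_def)
    ultimately have "\<omega> * (s / c) powr (- P) \<le> t"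
      by (simp only:)
    then have "\<omega> / t \<le> (s / c) powr P"
      using s assms(2) t0 by (simp add: powr_minus field_simps)
    then have "(\<omega> / t) powr (1 / P) \<le> ((s / c) powr P) powr (1 / P)"
      using \<omega> t0 P by (intro powr_mono2) auto
    also have "\<dots> = s / c" using s assms P by (simp add: powr_powr)
    finally show ?thesis
      using assms by (intro ennreal_leI) (simp add: field_simps)
  qed
qed

end

section \<open>Lower bounds for the envelope and its index\<close>

context
  fixes \<Omega> :: "'a::euclidean_space set" and p :: "'a \<Rightarrow> real" and x0 :: 'a and P K \<rho>0 :: real
  assumes \<Omega>: "\<Omega> \<in> sets lebesgue" and P: "0 < P" and K: "0 < K" and \<rho>0: "0 < \<rho>0" "ball x0 \<rho>0 \<subseteq> \<Omega>"
    and ball_le: "\<And>r. 0 < r \<Longrightarrow> r \<le> \<rho>0 \<Longrightarrow> var_norm \<Omega> p (indicator (ball x0 r)) \<le> ennreal (K * r powr (DIM('a) / P))"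
begin

lemmas norm_peak = lorentz_norm_peak_le[OF \<Omega> P K \<rho>0(2) ball_le]
lemmas rearr_peak = rearrangement_peak_ge[OF \<Omega> P K \<rho>0(2) ball_le]

text \<open>A peak is chosen for each \<open>t\<close>, with \<open>R\<close> the radius of the ball
  of volume \<open>t\<close> and cutoff at \<open>2 * R\<close>. The ratio of the radii being fixed,
  one constant normalizes all these peaks.\<close>

lemma growth_envelope_ge:
  assumes q: "1 \<le> q"
  obtains A \<epsilon> where "0 < A" "0 < \<epsilon>"
    "\<And>t. 0 < t \<Longrightarrow> t < \<epsilon> \<Longrightarrow> ennreal (A * t powr (- 1 / P)) \<le>
      growth_envelope_fun \<Omega> (lorentz_space \<Omega> p q) (lorentz_norm \<Omega> p q) t"
proof -
  let ?d = "real DIM('a)" and ?b = "DIM('a) / P"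
  define \<omega> where "\<omega> = unit_ball_vol ?d"
  have \<omega>: "0 < \<omega>" by (simp add: \<omega>_def)
  have pos: "0 < 1 + ?b * ln 2" using P by (intro add_pos_nonneg) auto
  \<comment> \<open>The reciprocal of the norm bound for height factor 1 and ratio 2.\<close>
  define c where "c = 1 / (K * (1 + ?b * ln 2) powr (1 / enn2real q))"
  have c: "0 < c" using K pos by (simp add: c_def)
  \<comment> \<open>The range of \<open>t\<close> is such that
    \<open>2 * R \<le> \<rho>0\<close>.\<close>
  show thesis
  proof (rule that[of "c * \<omega> powr (1 / P)" "\<omega> * (\<rho>0 / 2) powr ?d"])
    fix t :: real
    assume t: "0 < t" "t < \<omega> * (\<rho>0 / 2) powr ?d"
    define R where "R = (t / \<omega>) powr (1 / ?d)"
    have R: "0 < R" using t \<omega> by (simp add: R_def)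
    have Rd: "\<omega> * R powr ?d = t" using t \<omega> by (simp add: R_def powr_powr)
    have "R \<le> ((\<rho>0 / 2) powr ?d) powr (1 / ?d)"
      unfolding R_def using t \<omega> by (intro powr_mono2) (auto simp: field_simps)
    also have "\<dots> = \<rho>0 / 2" using \<rho>0 by (simp add: powr_powr)
    finally have R2: "2 * R \<le> \<rho>0" by simp
    let ?f = "peak x0 ?b c R (2 * R)"
    have N: "lorentz_norm \<Omega> p q ?f \<le> 1"
      using norm_peak[of c R "2 * R" q] c R R2 q K pos by (simp add: c_def)
    have "R powr ?d < (2 * R) powr ?d"
      using R by (intro powr_less_mono2) auto
    then have "t < \<omega> * (2 * R) powr ?d"
      using \<omega> Rd by (metis mult_strict_left_mono)
    then have "ennreal (c * (\<omega> / t) powr (1 / P)) \<le> rearrangement \<Omega> ?f t"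
      using rearr_peak[of c R "2 * R" t] c R R2 Rd by (simp add: \<omega>_def)
    also have "c * (\<omega> / t) powr (1 / P) = c * \<omega> powr (1 / P) * t powr (- 1 / P)"
      using t \<omega> by (simp add: powr_divide powr_minus field_simps)
    also have "rearrangement \<Omega> ?f t \<le> growth_envelope_fun \<Omega> (lorentz_space \<Omega> p q) (lorentz_norm \<Omega> p q) t"
      unfolding growth_envelope_fun_def lorentz_space_def using N
      by (intro SUP_upper) (auto intro: le_less_trans)
    finally show "ennreal (c * \<omega> powr (1 / P) * t powr (- 1 / P)) \<le>
        growth_envelope_fun \<Omega> (lorentz_space \<Omega> p q) (lorentz_norm \<Omega> p q) t" .
  qed (use c \<omega> \<rho>0 in auto)
qed

text \<open>Between \<open>\<omega> * R powr DIM('a)\<close> and \<open>\<tau>\<close>, inserting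
  the lower bound for the rearrangement cancels the powers of \<open>t\<close> down to a multiple of
  \<open>1 / t\<close>, so the functional picks up a logarithm to the power
  \<open>1 / v\<close>.\<close>

lemma envelope_functional_peak_ge:
  fixes R \<rho> \<tau> \<epsilon> v :: real
  defines "\<omega> \<equiv> unit_ball_vol DIM('a)"
  assumes R: "0 < R" "R \<le> \<rho>" "\<rho> \<le> \<rho>0" and v: "0 < v"
    and \<tau>: "\<omega> * R powr DIM('a) \<le> \<tau>" "\<tau> < \<epsilon>" "\<tau> < \<omega> * \<rho> powr DIM('a)"
  shows "ennreal ((\<omega> powr (v / P) / P * (ln \<tau> - ln (\<omega> * R powr DIM('a)))) powr (1 / v)) \<le>
    envelope_functional \<Omega> (\<lambda>t. t powr (- 1 / P)) \<epsilon> (ennreal v) (peak x0 (DIM('a) / P) 1 R \<rho>)"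
proof -
  have \<omega>: "0 < \<omega>" by (simp add: \<omega>_def)
  let ?f = "peak x0 (DIM('a) / P) 1 R \<rho>"
  let ?A = "\<omega> powr (v / P) / P"
  let ?\<sigma> = "\<omega> * R powr DIM('a)"
  have \<sigma>: "0 < ?\<sigma>" using \<omega> R by simp
  have "ennreal (?A * (ln \<tau> - ln ?\<sigma>)) = ennreal ?A * (\<integral>\<^sup>+t\<in>{?\<sigma>..\<tau>}. ennreal (1 / t) \<partial>lborel)"
    using \<sigma> \<tau> P by (subst nn_integral_inverse_Icc) (auto simp flip: ennreal_mult)
  also have "\<dots> = (\<integral>\<^sup>+t. ennreal ?A * (ennreal (1 / t) * indicator {?\<sigma>..\<tau>} t) \<partial>lborel)"
    by (subst nn_integral_cmult) auto
  also have "\<dots> \<le> (\<integral>\<^sup>+t\<in>{0<..<\<epsilon>}. epowr (rearrangement \<Omega> ?f t) v * ennreal (t powr (v / P - 1) / P) \<partial>lborel)"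
  proof (intro nn_integral_mono)
    fix t :: real
    show "ennreal ?A * (ennreal (1 / t) * indicator {?\<sigma>..\<tau>} t) \<le>
        epowr (rearrangement \<Omega> ?f t) v * ennreal (t powr (v / P - 1) / P) * indicator {0<..<\<epsilon>} t"
    proof (cases "t \<in> {?\<sigma>..\<tau>}")
      case True
      then have t: "0 < t" "t < \<epsilon>" using \<sigma> \<tau> by auto
      have "ennreal ?A * ennreal (1 / t) =
          ennreal ((1 * (\<omega> / t) powr (1 / P)) powr v) * ennreal (t powr (v / P - 1) / P)"
        using t \<omega> P by (simp add: powr_powr powr_divide powr_diff flip: ennreal_mult)
      also have "\<dots> = epowr (ennreal (1 * (\<omega> / t) powr (1 / P))) v * ennreal (t powr (v / P - 1) / P)"
        by (simp add: epowr_ennreal)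
      also have "\<dots> \<le> epowr (rearrangement \<Omega> ?f t) v * ennreal (t powr (v / P - 1) / P)"
        unfolding \<omega>_def using True R \<tau> v
        by (intro mult_right_mono epowr_mono rearr_peak) (auto simp: \<omega>_def)
      finally show ?thesis using True t by simp
    qed simp
  qed
  finally have "epowr (ennreal (?A * (ln \<tau> - ln ?\<sigma>))) (1 / v) \<le>
      envelope_functional \<Omega> (\<lambda>t. t powr (- 1 / P)) \<epsilon> (ennreal v) ?f"
    unfolding envelope_functional_powr[OF v P] using v by (intro epowr_mono) auto
  moreover have "ln ?\<sigma> \<le> ln \<tau>" using \<sigma> \<tau> by simp
  ultimately show ?thesis
    using P by (simp add: epowr_ennreal)
qed

text \<open>With \<open>x = 1 + ?b * ln (\<rho>0 / R)\<close> the norm is at most of order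
  \<open>x powr (1 / q)\<close> and the functional at least of order \<open>x powr (1 / v)\<close>.
  As \<open>v < q\<close>, a large \<open>x\<close> defeats any given \<open>c\<close>.\<close>

lemma envelope_index_ge:
  fixes v \<epsilon> c :: real
  assumes q: "1 \<le> q" and v: "0 < v" "ennreal v < q" and \<epsilon>: "0 < \<epsilon>" and c: "0 < c"
  obtains f where "f \<in> lorentz_space \<Omega> p q"
    "ennreal c * lorentz_norm \<Omega> p q f < envelope_functional \<Omega> (\<lambda>t. t powr (- 1 / P)) \<epsilon> (ennreal v) f"
proof -
  let ?d = "real DIM('a)" and ?b = "DIM('a) / P" and ?a = "1 / enn2real q"
  define \<omega> where "\<omega> = unit_ball_vol ?d"
  have \<omega>: "0 < \<omega>" by (simp add: \<omega>_def)
  have b: "0 < ?b" using P by simp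
  have a: "?a < 1 / v"
  proof (cases q)
    case (real r)
    with v show ?thesis by (auto simp: ennreal_less_iff intro!: divide_strict_left_mono)
  qed (use v in simp)
  define \<tau> where "\<tau> = min \<epsilon> (\<omega> * \<rho>0 powr ?d) / 2"
  have \<tau>: "0 < \<tau>" "\<tau> < \<epsilon>" "\<tau> < \<omega> * \<rho>0 powr ?d"
    using \<epsilon> \<omega> \<rho>0 by (auto simp: \<tau>_def min_def)
  \<comment> \<open>\<open>B\<close> collects the terms independent of \<open>R\<close>, so that the
    logarithm in the functional becomes \<open>B + P * (x - 1)\<close>.\<close>
  define B where "B = ln \<tau> - ln \<omega> - ?d * ln \<rho>0"
  define A where "A = \<omega> powr (v / P) / P"
  have A: "0 < A" using \<omega> P by (simp add: A_def)
  define C where "C = c * K / (A * P / 2) powr (1 / v)"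
  have C: "0 < C" using c K A P by (simp add: C_def)
  \<comment> \<open>Of the three bounds, the first gives \<open>R \<le> \<rho>0\<close>, the second
    gives \<open>P / 2 * x \<le> B + P * (x - 1)\<close>, and the third makes
    \<open>x powr (1 / v - ?a)\<close> at least \<open>C + 1\<close>, hence strictly above
    \<open>C\<close>.\<close>
  define x where "x = max (max 2 (2 * (P - B) / P)) ((C + 1) powr (1 / (1 / v - ?a)))"
  have x: "2 \<le> x" "2 * (P - B) / P \<le> x" "(C + 1) powr (1 / (1 / v - ?a)) \<le> x"
    by (auto simp: x_def)
  \<comment> \<open>The solution of \<open>1 + ?b * ln (\<rho>0 / R) = x\<close>.\<close>
  define R where "R = \<rho>0 * exp (- ((x - 1) / ?b))"
  have R: "0 < R" "R \<le> \<rho>0"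
  proof -
    have "0 \<le> (x - 1) / ?b" using b x by (intro divide_nonneg_pos) auto
    then show "R \<le> \<rho>0"
      using \<rho>0 by (simp only: R_def mult_le_cancel_left1 exp_le_one_iff) simp
  qed (use \<rho>0 in \<open>simp add: R_def\<close>)
  have lnR: "ln R = ln \<rho>0 - (x - 1) / ?b"
    using \<rho>0 by (simp add: R_def ln_mult)
  have x_eq: "1 + ?b * ln (\<rho>0 / R) = x"
    using \<rho>0 R P lnR by (simp add: ln_div)
  have "ln \<tau> - ln (\<omega> * R powr ?d) = ln \<tau> - ln \<omega> - ?d * ln \<rho>0 + ?d * ((x - 1) / ?b)"
    using \<omega> R lnR by (simp add: ln_mult ln_powr right_diff_distrib)
  also have "\<dots> = B + P * (x - 1)"
    by (simp add: B_def)
  finally have lns: "ln \<tau> - ln (\<omega> * R powr ?d) = B + P * (x - 1)" .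
  have half: "P / 2 * x \<le> B + P * (x - 1)"
    using x(2) P by (simp add: field_simps)
  have "0 < P / 2 * x" using P x by simp
  then have "ln (\<omega> * R powr ?d) \<le> ln \<tau>" using lns half by linarith
  then have \<tau>R: "\<omega> * R powr ?d \<le> \<tau>" using \<omega> R \<tau> by (subst (asm) ln_le_cancel_iff) auto
  let ?f = "peak x0 ?b 1 R \<rho>0"
  have N: "lorentz_norm \<Omega> p q ?f \<le> ennreal (K * x powr ?a)"
    using norm_peak[of 1 R \<rho>0 q] R q x_eq by simp
  have "C + 1 = ((C + 1) powr (1 / (1 / v - ?a))) powr (1 / v - ?a)"
  proof -
    have "v \<noteq> enn2real q" using a by auto
    then show ?thesis using a C by (simp add: powr_powr)
  qed
  also have "\<dots> \<le> x powr (1 / v - ?a)"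
    using a x by (intro powr_mono2) auto
  finally have "C < x powr (1 / v - ?a)" by simp
  then have "C * x powr ?a < x powr (1 / v)"
    using x by (simp add: powr_diff field_simps)
  then have "c * (K * x powr ?a) < (A * P / 2) powr (1 / v) * x powr (1 / v)"
    using A P by (simp add: C_def field_simps)
  also have "\<dots> = (A * (P / 2 * x)) powr (1 / v)"
    using A P x by (simp flip: powr_mult add: mult.assoc)
  also have "\<dots> \<le> (A * (B + P * (x - 1))) powr (1 / v)"
    using A P x v half by (intro powr_mono2 mult_left_mono) auto
  finally have less: "c * (K * x powr ?a) < (A * (B + P * (x - 1))) powr (1 / v)" .
  show thesis
  proof (rule that)
    show "?f \<in> lorentz_space \<Omega> p q"
      using N by (auto simp: lorentz_space_def intro: le_less_trans)
    have "ennreal c * lorentz_norm \<Omega> p q ?f \<le> ennreal c * ennreal (K * x powr ?a)"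
      using N by (intro mult_left_mono) auto
    also have "\<dots> < ennreal ((A * (B + P * (x - 1))) powr (1 / v))"
      using less c K by (simp add: ennreal_less_iff flip: ennreal_mult)
    also have "\<dots> \<le> envelope_functional \<Omega> (\<lambda>t. t powr (- 1 / P)) \<epsilon> (ennreal v) ?f"
      using envelope_functional_peak_ge[of R \<rho>0 v \<tau> \<epsilon>] R v \<tau> \<tau>R lns
      by (simp add: \<omega>_def A_def)
    finally show "ennreal c * lorentz_norm \<Omega> p q ?f <
        envelope_functional \<Omega> (\<lambda>t. t powr (- 1 / P)) \<epsilon> (ennreal v) ?f" .
  qed
qed

end

section \<open>The growth envelope of the variable Lorentz space\<close>

theorem corollary6p12:
  fixes \<Omega> :: "(real ^ 'd) set" and p :: "real ^ 'd \<Rightarrow> real" and q :: ennreal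
  assumes "open \<Omega>" and "emeasure lebesgue \<Omega> < \<infinity>"
    and "p \<in> exponent_functions \<Omega>" and "exp_plus \<Omega> p < \<infinity>"
    and "1 < q"
    and "\<exists>x0\<in>\<Omega>. ereal (p x0) = exp_minus \<Omega> p \<and> log_Hoelder_at \<Omega> x0 p"
  shows "has_growth_envelope \<Omega> (lorentz_space \<Omega> p q) (lorentz_norm \<Omega> p q)
           (\<lambda>t. t powr (- 1 / real_of_ereal (exp_minus \<Omega> p))) q"
proof -
  obtain x0 where x0: "x0 \<in> \<Omega>" "ereal (p x0) = exp_minus \<Omega> p" "log_Hoelder_at \<Omega> x0 p"
    using assms(6) by blast
  define P where "P = p x0"
  have P_eq: "real_of_ereal (exp_minus \<Omega> p) = P"
    using x0(2)[symmetric] by (simp add: P_def)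
  have P: "0 < P" using assms(3) x0(1) by (simp add: exponent_functions_def P_def)
  have \<Omega>: "\<Omega> \<in> sets lebesgue" using assms(1) by (simp add: borel_open)
  \<comment> \<open>Through negation, the almost-everywhere bound for the essential supremum yields
    \<open>P \<le> p x\<close> almost everywhere.\<close>
  have "esssup (lebesgue_on \<Omega>) (\<lambda>x. - ereal (p x)) = - ereal P"
    using x0(2) by (metis P_def ereal_uminus_uminus essinf_def exp_minus_def)
  then have "AE x in lebesgue_on \<Omega>. - ereal (p x) \<le> - ereal P"
    using esssup_AE[of "\<lambda>x. - ereal (p x)" "lebesgue_on \<Omega>"] by simp
  then have pP: "AE x in lebesgue_on \<Omega>. P \<le> p x" by simp
  obtain K \<rho> where K: "0 < K" and \<rho>: "0 < \<rho>" "ball x0 \<rho> \<subseteq> \<Omega>"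
    and ball_le: "\<And>r. 0 < r \<Longrightarrow> r \<le> \<rho> \<Longrightarrow>
      var_norm \<Omega> p (indicator (ball x0 r)) \<le> ennreal (K * r powr (DIM(real ^ 'd) / P))"
    using var_norm_indicator_ball_le[OF assms(1) x0(1) P[unfolded P_def] pP[unfolded P_def] x0(3)]
    unfolding P_def by blast
  have q: "0 < q" "1 \<le> q" using assms(5) by (auto intro: le_less_trans[of 0 1])
  define B where "B = (if q = \<infinity> then 1 else enn2real q powr (1 / enn2real q))"
  have B: "0 < B" using q by (cases q) (auto simp: B_def)
  have rearr: "rearrangement \<Omega> f t \<le> ennreal (B * t powr (- 1 / P)) * lorentz_norm \<Omega> p q f"
    if "f \<in> lorentz_space \<Omega> p q" "0 < t" "t \<le> 1" for f t
    using rearrangement_le_lorentz_norm[OF _ pP P q(1) that(2,3), of f] that(1)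
    unfolding B_def lorentz_space_def by simp
  obtain A \<delta> where A: "0 < A" "0 < \<delta>" "\<And>t. 0 < t \<Longrightarrow> t < \<delta> \<Longrightarrow> ennreal (A * t powr (- 1 / P)) \<le>
      growth_envelope_fun \<Omega> (lorentz_space \<Omega> p q) (lorentz_norm \<Omega> p q) t"
    using growth_envelope_ge[OF \<Omega> P K \<rho> ball_le q(2)] by blast
  have upper: "growth_envelope_fun \<Omega> (lorentz_space \<Omega> p q) (lorentz_norm \<Omega> p q) t \<le>
      ennreal (B * t powr (- 1 / P))" if "0 < t" "t \<le> 1" for t
    unfolding growth_envelope_fun_def
  proof (rule SUP_least, clarify)
    fix f assume f: "f \<in> lorentz_space \<Omega> p q" "lorentz_norm \<Omega> p q f \<le> 1"
    have "rearrangement \<Omega> f t \<le> ennreal (B * t powr (- 1 / P)) * lorentz_norm \<Omega> p q f"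
      by (rule rearr[OF f(1) that])
    also have "\<dots> \<le> ennreal (B * t powr (- 1 / P)) * 1"
      by (intro mult_left_mono f) auto
    finally show "rearrangement \<Omega> f t \<le> ennreal (B * t powr (- 1 / P))" by simp
  qed
  \<comment> \<open>Every \<open>\<epsilon> < 1\<close> is small enough: it keeps \<open>t\<close>
    in the range of the capped estimates.\<close>
  have index: "q = Inf {v. 0 < v \<and> (\<exists>c::real>0. \<forall>f\<in>lorentz_space \<Omega> p q.
      envelope_functional \<Omega> (\<lambda>t. t powr (- 1 / P)) \<epsilon> v f \<le> ennreal c * lorentz_norm \<Omega> p q f)}"
    (is "q = Inf ?V") if \<epsilon>: "0 < \<epsilon>" "\<epsilon> < 1" for \<epsilon>
  proof (rule antisym)
    \<comment> \<open>The exponent \<open>q\<close> itself is admissible: with constant 1 by the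
      layer-cake bound if \<open>q\<close> is finite, with \<open>B\<close> by the pointwise bound
      on the rearrangement if \<open>q = \<infinity>\<close>.\<close>
    have "\<exists>c::real>0. \<forall>f\<in>lorentz_space \<Omega> p q.
        envelope_functional \<Omega> (\<lambda>t. t powr (- 1 / P)) \<epsilon> q f \<le> ennreal c * lorentz_norm \<Omega> p q f"
    proof (cases q)
      case (real r)
      then show ?thesis
        using envelope_functional_le_lorentz_norm[OF \<Omega> assms(2) _ pP P, of _ r \<epsilon>] q \<epsilon>
        by (intro exI[of _ 1]) (auto simp: lorentz_space_def)
    next
      case top
      have "rearrangement \<Omega> f t / ennreal (t powr (- 1 / P)) \<le> ennreal B * lorentz_norm \<Omega> p q f"
        if f: "f \<in> lorentz_space \<Omega> p q" and t: "0 < t" "t < \<epsilon>" for f t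
      proof -
        have "rearrangement \<Omega> f t / ennreal (t powr (- 1 / P)) \<le>
            ennreal (B * t powr (- 1 / P)) * lorentz_norm \<Omega> p q f / ennreal (t powr (- 1 / P))"
          using t \<epsilon> by (intro divide_right_mono_ennreal rearr f) auto
        also have "\<dots> = ennreal (B * t powr (- 1 / P)) / ennreal (t powr (- 1 / P)) * lorentz_norm \<Omega> p q f"
          by (simp add: divide_ennreal_def mult_ac)
        also have "\<dots> = ennreal B * lorentz_norm \<Omega> p q f"
          using t B by (simp add: divide_ennreal)
        finally show ?thesis .
      qed
      then show ?thesis
        using top B by (intro exI[of _ B]) (auto simp: envelope_functional_def intro!: SUP_least)
    qed
    then show "Inf ?V \<le> q" using q by (intro Inf_lower) auto
    show "q \<le> Inf ?V"
    proof (rule Inf_greatest, rule ccontr)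
      fix v assume v: "v \<in> ?V" and "\<not> q \<le> v"
      \<comment> \<open>Such a \<open>v\<close> is finite even for \<open>q = \<infinity>\<close>,
        so a suitable peak violates the inequality with its constant \<open>c\<close>.\<close>
      then have "v < q" by simp
      then have "v < top" by (auto simp: less_top[symmetric] top_unique)
      then obtain v' where v': "v = ennreal v'" "0 < v'"
        using v by (cases v) (auto simp: ennreal_less_zero_iff)
      obtain c :: real where c: "0 < c" "\<And>f. f \<in> lorentz_space \<Omega> p q \<Longrightarrow>
          envelope_functional \<Omega> (\<lambda>t. t powr (- 1 / P)) \<epsilon> v f \<le> ennreal c * lorentz_norm \<Omega> p q f"
        using v by blast
      obtain f where "f \<in> lorentz_space \<Omega> p q"
        "ennreal c * lorentz_norm \<Omega> p q f < envelope_functional \<Omega> (\<lambda>t. t powr (- 1 / P)) \<epsilon> (ennreal v') f"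
        using envelope_index_ge[OF \<Omega> P K \<rho> ball_le q(2) v'(2) _ \<epsilon>(1) c(1)] \<open>v < q\<close> v' by blast
      with c(2)[of f] v' show False by simp
    qed
  qed
  have "(\<lambda>t. t powr (- 1 / P)) C1_differentiable_on {0<..}"
    unfolding C1_differentiable_on_def
  proof (intro exI conjI ballI)
    show "((\<lambda>t. t powr (- 1 / P)) has_vector_derivative (- 1 / P) * t powr (- 1 / P - 1)) (at t)"
      if "t \<in> {0<..}" for t
      using powr_has_deriv[of t P] that
      by (simp only: has_real_derivative_iff_has_vector_derivative greaterThan_iff)
    show "continuous_on {0<..} (\<lambda>t. (- 1 / P) * t powr (- 1 / P - 1))"
      using P by (intro continuous_intros) auto
  qed
  moreover have "antimono_on {0<..} (\<lambda>t. t powr (- 1 / P))"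
    using P by (intro monotone_onI) (auto intro!: powr_mono2')
  moreover have "\<exists>\<epsilon>>0. \<exists>A>0. \<exists>B>0. \<forall>t. 0 < t \<and> t < \<epsilon> \<longrightarrow>
      ennreal (A * t powr (- 1 / P)) \<le> growth_envelope_fun \<Omega> (lorentz_space \<Omega> p q) (lorentz_norm \<Omega> p q) t \<and>
      growth_envelope_fun \<Omega> (lorentz_space \<Omega> p q) (lorentz_norm \<Omega> p q) t \<le> ennreal (B * t powr (- 1 / P))"
    \<comment> \<open>The lower bound holds for \<open>t < \<delta>\<close> and the upper one for
      \<open>t \<le> 1\<close>, hence the minimum.\<close>
    using A B upper by (intro exI[of _ "min 1 \<delta>"] conjI exI[of _ A] exI[of _ B] allI impI) auto
  moreover have "\<forall>\<^sub>F \<epsilon> in at_right 0. q = Inf {v. 0 < v \<and> (\<exists>c::real>0. \<forall>f\<in>lorentz_space \<Omega> p q.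
      envelope_functional \<Omega> (\<lambda>t. t powr (- 1 / P)) \<epsilon> v f \<le> ennreal c * lorentz_norm \<Omega> p q f)}"
    by (rule eventually_mono[OF eventually_at_right_real[of 0 "1::real"]]) (simp, rule index, auto)
  ultimately show ?thesis
    unfolding has_growth_envelope_def P_eq by simp
qed

end
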